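(* Let $\Lambda_t:=\{\lambda_t>0:\ \mathcal R(\lambda_t)-\mathcal C(\lambda_t,\lambda_s)=0\ \text{for all }\lambda_s>0\}$. Then $\lambda_t>0$ belongs to $\Lambda_t$ if and only if $d_j=0$ for every $j\in\{1,\dots,\tilde m\}$ (where $d_j=d_j(\lambda_t)$). Moreover, in the nontrivial case $r^2+\sigma^2>0$, $|\Lambda_t|\le 4m-1$, where $m$ is the number of distinct eigenvalues of $\Sigma_t$.
   Context: Let $p,n_t,n_s$ be positive integers, $\gamma_t=p/n_t$, $\gamma_s=p/n_s$, $\overline{\mathrm{tr}}(A)=\mathrm{tr}(A)/p$. Let $\Sigma_t,\Sigma_s\in\mathbb R^{p\times p}$ be positive definite and simultaneously diagonalizable: $\Sigma_t=U^\top\mathrm{diag}(\sigma_1,\dots,\sigma_p)U$, $\Sigma_s=U^\top\mathrm{diag}(\tilde\sigma_1,\dots,\tilde\sigma_p)U$ with $U$ orthogonal. Let $\beta\in\mathbb R^p$, $r^2=\|\beta\|_2^2$, $\sigma^2\ge0$. For $\lambda_t,\lambda_s>0$ let $\kappa_t=\kappa_t(\lambda_t)>0$ and $\kappa_s=\kappa_s(\lambda_s)>0$ be the unique positive solutions of $\kappa_t=\lambda_t+\gamma_t\kappa_t\overline{\mathrm{tr}}(\Sigma_t(\Sigma_t+\kappa_tI_p)^{-1})$ and $\kappa_s=\lambda_s+\gamma_s\kappa_s\overline{\mathrm{tr}}(\Sigma_s(\Sigma_s+\kappa_sI_p)^{-1})$. Set $G_t=(\Sigma_t+\kappa_tI_p)^{-1}$,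 $G_s=(\Sigma_s+\kappa_sI_p)^{-1}$, $q_{i,j}=\beta^\top G_t^iG_s^j\Sigma_t\beta$, $t_{i,j}=\gamma_t\overline{\mathrm{tr}}(\Sigma_t^2G_t^iG_s^j)$, $b_t=(1-t_{2,0})^{-1}$. The limiting teacher risk and limiting teacher-student residual correlation are $$\mathcal R(\lambda_t)=\sigma^2+\kappa_t^2b_tq_{2,0}+\sigma^2b_tt_{2,0},\qquad \mathcal C(\lambda_t,\lambda_s)=\mathcal R(\lambda_t)-\kappa_s\big(-\kappa_tq_{1,1}+\kappa_t^2q_{2,1}+\kappa_t^2b_tt_{2,1}q_{2,0}+\sigma^2b_tt_{2,1}\big).$$ Let $v_i=((U\beta)_i)^2$ for $i=1,\dots,p$. Let $\tilde\sigma_{(1)}<\dots<\tilde\sigma_{(\tilde m)}$ be the distinct eigenvalues of $\Sigma_s$. Define $$c_i=\frac{\kappa_t\sigma_i^2}{(\sigma_i+\kappa_t)^2}\Big(\frac{\kappa_t^2b_tq_{2,0}+\sigma^2b_t}{\kappa_tn_t}-v_i\Big)\ (1\le i\le p),\qquad d_j=\sum_{k:\tilde\sigma_k=\tilde\sigma_{(j)}}c_k\ (1\le j\le\tilde m).$$ *)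

theory Defs
  imports "HOL-Analysis.Analysis"
begin

text \<open>On \<open>real ^ 'p ^ 'p\<close> the operators \<open>*\<close> and \<open>^\<close> act entrywise;
  matrix powers are therefore defined through \<open>**\<close>.\<close>

primrec matpow :: "real ^ 'p ^ 'p \<Rightarrow> nat \<Rightarrow> real ^ 'p ^ 'p" where
  "matpow A 0 = mat 1"
| "matpow A (Suc k) = A ** matpow A k"

definition diag_matrix :: "real ^ 'p \<Rightarrow> real ^ 'p ^ 'p" where
  "diag_matrix s = (\<chi> i j. if i = j then s $ i else 0)"

definition pos_def_matrix :: "real ^ 'p ^ 'p \<Rightarrow> bool" where
  "pos_def_matrix A \<longleftrightarrow> transpose A = A \<and> (\<forall>x. x \<noteq> 0 \<longrightarrow> 0 < x \<bullet> (A *v x))"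

definition eigenvalues :: "real ^ 'p ^ 'p \<Rightarrow> real set" where
  "eigenvalues A = {e. \<exists>x. x \<noteq> 0 \<and> A *v x = e *\<^sub>R x}"

definition ntrace :: "real ^ 'p ^ 'p \<Rightarrow> real" where
  "ntrace A = trace A / real CARD('p)"

text \<open>The ratio \<open>\<gamma> = p / n\<close>; the matrix argument only serves to fix the type \<open>'p\<close>,
  whose cardinality is the dimension \<open>p\<close>.\<close>

definition aspect :: "nat \<Rightarrow> real ^ 'p ^ 'p \<Rightarrow> real" where
  "aspect n (\<Sigma> :: real ^ 'p ^ 'p) = real CARD('p) / real n"

definition resolvent :: "real ^ 'p ^ 'p \<Rightarrow> real \<Rightarrow> real ^ 'p ^ 'p" where
  "resolvent \<Sigma> k = matrix_inv (\<Sigma> + mat k)"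

text \<open>For positive definite \<open>\<Sigma>\<close>, \<open>n > 0\<close> and \<open>l > 0\<close> the positive solution below exists and is
  unique: \<open>1 - \<gamma> tr(\<Sigma> (\<Sigma> + k I)\<^sup>-\<^sup>1) / p\<close> is strictly increasing in \<open>k\<close>, with limit \<open>1\<close>.\<close>

definition kappa :: "nat \<Rightarrow> real ^ 'p ^ 'p \<Rightarrow> real \<Rightarrow> real" where
  "kappa n \<Sigma> l =
     (THE k. 0 < k \<and> k = l + aspect n \<Sigma> * k * ntrace (\<Sigma> ** resolvent \<Sigma> k))"

definition qform ::
  "real ^ 'p ^ 'p \<Rightarrow> real ^ 'p \<Rightarrow> real ^ 'p ^ 'p \<Rightarrow> real ^ 'p ^ 'p \<Rightarrow> nat \<Rightarrow> nat \<Rightarrow> real" where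
  "qform \<Sigma>\<^sub>t \<beta> G\<^sub>t G\<^sub>s i j = \<beta> \<bullet> ((matpow G\<^sub>t i ** matpow G\<^sub>s j ** \<Sigma>\<^sub>t) *v \<beta>)"

definition tform ::
  "nat \<Rightarrow> real ^ 'p ^ 'p \<Rightarrow> real ^ 'p ^ 'p \<Rightarrow> real ^ 'p ^ 'p \<Rightarrow> nat \<Rightarrow> nat \<Rightarrow> real" where
  "tform n\<^sub>t \<Sigma>\<^sub>t G\<^sub>t G\<^sub>s i j =
     aspect n\<^sub>t \<Sigma>\<^sub>t * ntrace (matpow \<Sigma>\<^sub>t 2 ** matpow G\<^sub>t i ** matpow G\<^sub>s j)"

text \<open>The quantities \<open>q\<^sub>2\<^sub>,\<^sub>0\<close> and \<open>t\<^sub>2\<^sub>,\<^sub>0\<close> do not involve \<open>G\<^sub>s\<close>, so that \<open>b\<^sub>t\<close> and the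
  teacher risk are functions of the teacher's penalty alone. Below, \<open>mat 1\<close> is passed as
  an irrelevant second resolvent wherever \<open>j = 0\<close>.\<close>

lemma qform_0_right: "qform \<Sigma>\<^sub>t \<beta> G\<^sub>t G\<^sub>s i 0 = qform \<Sigma>\<^sub>t \<beta> G\<^sub>t G\<^sub>s' i 0"
  by (simp add: qform_def)

lemma tform_0_right: "tform n\<^sub>t \<Sigma>\<^sub>t G\<^sub>t G\<^sub>s i 0 = tform n\<^sub>t \<Sigma>\<^sub>t G\<^sub>t G\<^sub>s' i 0"
  by (simp add: tform_def)

definition b_teacher :: "nat \<Rightarrow> real ^ 'p ^ 'p \<Rightarrow> real \<Rightarrow> real" where
  "b_teacher n\<^sub>t \<Sigma>\<^sub>t l\<^sub>t =
     inverse (1 - tform n\<^sub>t \<Sigma>\<^sub>t (resolvent \<Sigma>\<^sub>t (kappa n\<^sub>t \<Sigma>\<^sub>t l\<^sub>t)) (mat 1) 2 0)"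

text \<open>Throughout, \<open>\<sigma>2\<close> stands for the noise variance \<open>\<sigma>\<^sup>2\<close>.\<close>

definition teacher_risk ::
  "nat \<Rightarrow> real ^ 'p ^ 'p \<Rightarrow> real ^ 'p \<Rightarrow> real \<Rightarrow> real \<Rightarrow> real" where
  "teacher_risk n\<^sub>t \<Sigma>\<^sub>t \<beta> \<sigma>2 l\<^sub>t =
     (let \<kappa>\<^sub>t = kappa n\<^sub>t \<Sigma>\<^sub>t l\<^sub>t;
          G\<^sub>t = resolvent \<Sigma>\<^sub>t \<kappa>\<^sub>t;
          b\<^sub>t = b_teacher n\<^sub>t \<Sigma>\<^sub>t l\<^sub>t
      in \<sigma>2 + \<kappa>\<^sub>t\<^sup>2 * b\<^sub>t * qform \<Sigma>\<^sub>t \<beta> G\<^sub>t (mat 1) 2 0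
            + \<sigma>2 * b\<^sub>t * tform n\<^sub>t \<Sigma>\<^sub>t G\<^sub>t (mat 1) 2 0)"

definition residual_corr ::
  "nat \<Rightarrow> nat \<Rightarrow> real ^ 'p ^ 'p \<Rightarrow> real ^ 'p ^ 'p \<Rightarrow> real ^ 'p \<Rightarrow> real \<Rightarrow> real \<Rightarrow> real \<Rightarrow> real" where
  "residual_corr n\<^sub>t n\<^sub>s \<Sigma>\<^sub>t \<Sigma>\<^sub>s \<beta> \<sigma>2 l\<^sub>t l\<^sub>s =
     (let \<kappa>\<^sub>t = kappa n\<^sub>t \<Sigma>\<^sub>t l\<^sub>t;
          \<kappa>\<^sub>s = kappa n\<^sub>s \<Sigma>\<^sub>s l\<^sub>s;
          G\<^sub>t = resolvent \<Sigma>\<^sub>t \<kappa>\<^sub>t;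
          G\<^sub>s = resolvent \<Sigma>\<^sub>s \<kappa>\<^sub>s;
          b\<^sub>t = b_teacher n\<^sub>t \<Sigma>\<^sub>t l\<^sub>t;
          q = qform \<Sigma>\<^sub>t \<beta> G\<^sub>t G\<^sub>s;
          t = tform n\<^sub>t \<Sigma>\<^sub>t G\<^sub>t G\<^sub>s
      in teacher_risk n\<^sub>t \<Sigma>\<^sub>t \<beta> \<sigma>2 l\<^sub>t
         - \<kappa>\<^sub>s * (- \<kappa>\<^sub>t * q 1 1 + \<kappa>\<^sub>t\<^sup>2 * q 2 1 + \<kappa>\<^sub>t\<^sup>2 * b\<^sub>t * t 2 1 * q 2 0 + \<sigma>2 * b\<^sub>t * t 2 1))"

definition Lambda_t ::
  "nat \<Rightarrow> nat \<Rightarrow> real ^ 'p ^ 'p \<Rightarrow> real ^ 'p ^ 'p \<Rightarrow> real ^ 'p \<Rightarrow> real \<Rightarrow> real set" where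
  "Lambda_t n\<^sub>t n\<^sub>s \<Sigma>\<^sub>t \<Sigma>\<^sub>s \<beta> \<sigma>2 =
     {l\<^sub>t. 0 < l\<^sub>t \<and>
        (\<forall>l\<^sub>s>0. teacher_risk n\<^sub>t \<Sigma>\<^sub>t \<beta> \<sigma>2 l\<^sub>t - residual_corr n\<^sub>t n\<^sub>s \<Sigma>\<^sub>t \<Sigma>\<^sub>s \<beta> \<sigma>2 l\<^sub>t l\<^sub>s = 0)}"

text \<open>The vectors \<open>s\<close> and \<open>s'\<close> hold the eigenvalues of the teacher's and of the student's covariance, in the order fixed by the common diagonalization
  \<open>\<Sigma>\<^sub>t = U\<^sup>T diag(s) U\<close>, \<open>\<Sigma>\<^sub>s = U\<^sup>T diag(s') U\<close>.\<close>

definition c_coeff ::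
  "nat \<Rightarrow> real ^ 'p ^ 'p \<Rightarrow> real ^ 'p \<Rightarrow> real \<Rightarrow> real ^ 'p ^ 'p \<Rightarrow> real ^ 'p \<Rightarrow> real \<Rightarrow> 'p \<Rightarrow> real" where
  "c_coeff n\<^sub>t \<Sigma>\<^sub>t \<beta> \<sigma>2 U s l\<^sub>t i =
     (let \<kappa>\<^sub>t = kappa n\<^sub>t \<Sigma>\<^sub>t l\<^sub>t;
          G\<^sub>t = resolvent \<Sigma>\<^sub>t \<kappa>\<^sub>t;
          b\<^sub>t = b_teacher n\<^sub>t \<Sigma>\<^sub>t l\<^sub>t;
          v\<^sub>i = ((U *v \<beta>) $ i)\<^sup>2
      in \<kappa>\<^sub>t * (s $ i)\<^sup>2 / (s $ i + \<kappa>\<^sub>t)\<^sup>2 *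
           ((\<kappa>\<^sub>t\<^sup>2 * b\<^sub>t * qform \<Sigma>\<^sub>t \<beta> G\<^sub>t (mat 1) 2 0 + \<sigma>2 * b\<^sub>t) / (\<kappa>\<^sub>t * real n\<^sub>t) - v\<^sub>i))"

definition ordered_eigenvalue :: "real ^ 'p ^ 'p \<Rightarrow> nat \<Rightarrow> real" where
  "ordered_eigenvalue A j = sorted_list_of_set (eigenvalues A) ! (j - 1)"

definition d_coeff ::
  "nat \<Rightarrow> real ^ 'p ^ 'p \<Rightarrow> real ^ 'p ^ 'p \<Rightarrow> real ^ 'p \<Rightarrow> real \<Rightarrow> real ^ 'p ^ 'p \<Rightarrow>
     real ^ 'p \<Rightarrow> real ^ 'p \<Rightarrow> real \<Rightarrow> nat \<Rightarrow> real" where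
  "d_coeff n\<^sub>t \<Sigma>\<^sub>t \<Sigma>\<^sub>s \<beta> \<sigma>2 U s s' l\<^sub>t j =
     (\<Sum>k | s' $ k = ordered_eigenvalue \<Sigma>\<^sub>s j. c_coeff n\<^sub>t \<Sigma>\<^sub>t \<beta> \<sigma>2 U s l\<^sub>t k)"

end

theory Submission
  imports Defs
begin

text \<open>
  In the common eigenbasis every matrix involved is diagonal, and the difference of risk and
  correlation becomes \<open>\<kappa>\<^sub>s (\<Sum>\<^sub>k c\<^sub>k / (\<sigma>'\<^sub>k + \<kappa>\<^sub>s))\<close> (\<open>risk_gap\<close>): only the resolvent of the
  student depends on its penalty. The penalty and the effective regularization determine each
  other through \<open>l = k - (\<Sum>\<^sub>i k \<sigma>\<^sub>i / (\<sigma>\<^sub>i + k)) / n\<close> (\<open>kappa_eq_iff\<close>), and the right-hand side is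
  positive for all large \<open>k\<close>, so that \<open>\<kappa>\<^sub>s\<close> takes infinitely many values. A combination of
  the fractions \<open>1 / (e + x)\<close> with distinct poles that vanishes at infinitely many \<open>x\<close> has zero
  coefficients (\<open>partial_fractions_independent\<close>); grouping the \<open>c\<^sub>k\<close> by the eigenvalue of
  \<open>\<Sigma>\<^sub>s\<close>, this yields the characterization by the \<open>d\<^sub>j\<close>.

  For the cardinality only the sum of all \<open>d\<^sub>j\<close> matters. It equals \<open>\<Sum>\<^sub>k c\<^sub>k\<close>, and its vanishing
  says that \<open>(\<kappa>\<^sup>2 q + \<sigma>\<^sup>2) t = (1 - t) \<kappa> w\<close>, where \<open>q\<close>, \<open>t\<close> and \<open>w\<close> are combinations
  of the \<open>1 / (\<sigma>\<^sub>i + \<kappa>)\<^sup>2\<close>. Clearing denominators gives a polynomial equation in \<open>\<kappa> = \<kappa>\<^sub>t\<close>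
  in which the term coming from \<open>\<kappa> w\<close> has degree exactly \<open>4 m - 1\<close> if \<open>\<beta> \<noteq> 0\<close> and all other
  terms have smaller degree (\<open>card_balance_solutions\<close>). Since \<open>\<kappa>\<^sub>t\<close> determines \<open>\<lambda>\<^sub>t\<close>, this
  bounds the cardinality. If \<open>\<beta> = 0\<close>, the equation reads \<open>\<sigma>\<^sup>2 t = 0\<close> and has no
  solution.
\<close>

section \<open>Partial fractions\<close>

text \<open>The numerator of \<open>\<Sum>\<^sub>i a\<^sub>i / (s\<^sub>i + x)\<^sup>r\<close> over the common denominator in which each
  distinct pole occurs once; the number of distinct poles, not of summands, is
  what enters the degree.\<close>

definition pf_denom :: "nat \<Rightarrow> real set \<Rightarrow> real poly" where
  "pf_denom r E = (\<Prod>e\<in>E. [:e, 1:] ^ r)"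

definition pf_numer :: "nat \<Rightarrow> 'i set \<Rightarrow> ('i \<Rightarrow> real) \<Rightarrow> ('i \<Rightarrow> real) \<Rightarrow> real poly" where
  "pf_numer r I s a = (\<Sum>i\<in>I. smult (a i) (pf_denom r (s ` I - {s i})))"

lemma poly_pf_denom: "poly (pf_denom r E) x = (\<Prod>e\<in>E. (e + x) ^ r)"
  by (simp add: pf_denom_def poly_prod)

lemma pf_denom_nonzero: "pf_denom r E \<noteq> 0"
  by (cases "finite E") (auto simp: pf_denom_def)

lemma degree_pf_denom: "degree (pf_denom r E) = r * card E"
proof -
  have "degree (pf_denom r E) = (\<Sum>e\<in>E. degree ([:e, 1:] ^ r))"
    unfolding pf_denom_def by (rule degree_prod_sum_eq) simp
  then show ?thesis
    by (simp add: degree_linear_power)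
qed

lemma lead_coeff_pf_denom: "lead_coeff (pf_denom r E) = 1"
  by (simp add: pf_denom_def lead_coeff_prod lead_coeff_power)

lemma poly_pf_numer:
  assumes "finite I" and nz: "\<And>i. i \<in> I \<Longrightarrow> s i + x \<noteq> 0"
  shows "poly (pf_numer r I s a) x = poly (pf_denom r (s ` I)) x * (\<Sum>i\<in>I. a i / (s i + x) ^ r)"
proof -
  have "poly (pf_denom r (s ` I)) x * (a i / (s i + x) ^ r)
      = poly (smult (a i) (pf_denom r (s ` I - {s i}))) x" if "i \<in> I" for i
  proof -
    have "poly (pf_denom r (s ` I)) x = (s i + x) ^ r * poly (pf_denom r (s ` I - {s i})) x"
      using that assms(1) unfolding poly_pf_denom by (intro prod.remove) auto
    then show ?thesis
      using nz[OF that] by simp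
  qed
  then show ?thesis
    by (simp add: pf_numer_def poly_sum sum_distrib_left)
qed

lemma degree_pf_numer:
  assumes "finite I"
  shows "degree (pf_numer r I s a) \<le> r * (card (s ` I) - 1)"
  unfolding pf_numer_def using assms
  by (intro degree_sum_le order.trans[OF degree_smult_le]) (auto simp: degree_pf_denom)

text \<open>All cofactors are monic of the same degree, so the top coefficient of the
  numerator is the total weight.\<close>

lemma coeff_pf_numer:
  assumes "finite I"
  shows "poly.coeff (pf_numer r I s a) (r * (card (s ` I) - 1)) = (\<Sum>i\<in>I. a i)"
proof -
  have "poly.coeff (pf_denom r (s ` I - {s i})) (r * (card (s ` I) - 1)) = 1" if "i \<in> I" for i
    using lead_coeff_pf_denom[of r "s ` I - {s i}"] that assms by (simp add: degree_pf_denom)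
  then show ?thesis
    by (simp add: pf_numer_def coeff_sum)
qed

text \<open>The numerator has infinitely many roots, hence vanishes identically; its value at the pole
  \<open>- e\<close> isolates the coefficient of that pole.\<close>

lemma partial_fractions_independent:
  fixes d :: "real \<Rightarrow> real"
  assumes "finite E" and "infinite K"
    and nz: "\<And>e x. e \<in> E \<Longrightarrow> x \<in> K \<Longrightarrow> e + x \<noteq> 0"
    and eq: "\<And>x. x \<in> K \<Longrightarrow> (\<Sum>e\<in>E. d e / (e + x)) = 0"
    and "e \<in> E"
  shows "d e = 0"
proof -
  let ?p = "pf_numer 1 E (\<lambda>e. e) d"
  have "poly ?p x = 0" if "x \<in> K" for x
    using poly_pf_numer[of E "\<lambda>e. e" x 1 d] assms(1) nz that eq[OF that] by simp
  then have "K \<subseteq> {x. poly ?p x = 0}"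
    by blast
  with \<open>infinite K\<close> have "infinite {x. poly ?p x = 0}"
    using finite_subset by blast
  then have "?p = 0"
    using poly_roots_finite by blast
  have zero: "(\<Prod>e'\<in>E - {i}. e' - e) = 0" if "i \<noteq> e" for i
    using assms(1) \<open>e \<in> E\<close> that by (intro prod_zero) auto
  have "0 = poly ?p (- e)"
    unfolding \<open>?p = 0\<close> by simp
  also have "\<dots> = (\<Sum>i\<in>E. d i * (\<Prod>e'\<in>E - {i}. e' - e))"
    by (simp add: pf_numer_def poly_sum poly_pf_denom)
  also have "\<dots> = (\<Sum>i\<in>E. if i = e then d e * (\<Prod>e'\<in>E - {e}. e' - e) else 0)"
    using assms(1) \<open>e \<in> E\<close> by (intro sum.cong refl) (simp add: zero)
  also have "\<dots> = d e * (\<Prod>e'\<in>E - {e}. e' - e)"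
    using assms(1) \<open>e \<in> E\<close> by (simp add: sum.delta')
  finally show ?thesis
    using assms(1) by auto
qed

text \<open>Counting the solutions of the equation to which \<open>\<Sum>\<^sub>k c\<^sub>k = 0\<close> reduces. Over the
  denominator \<open>D\<^sup>2\<close>, where \<open>D\<close> is the product of the \<open>(e + k)\<^sup>2\<close>, the term \<open>k w\<close> contributes
  degree \<open>1 + (2 m - 2) + 2 m = 4 m - 1\<close> and every other term at most \<open>4 m - 2\<close>.\<close>

lemma card_balance_solutions:
  fixes s u v w :: "'i \<Rightarrow> real" and c :: real
  assumes "finite I" and "I \<noteq> {}" and w: "(\<Sum>i\<in>I. w i) \<noteq> 0"
  defines "f \<equiv> \<lambda>a k. \<Sum>i\<in>I. a i / (s i + k)\<^sup>2"
  defines "S \<equiv> {k. (\<forall>i\<in>I. s i + k \<noteq> 0) \<and> (k\<^sup>2 * f u k + c) * f v k = (1 - f v k) * k * f w k}"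
  shows "finite S" and "card S \<le> 4 * card (s ` I) - 1"
proof -
  define m where "m = card (s ` I)"
  define D where "D = pf_denom 2 (s ` I)"
  define N where "N = (\<lambda>a. pf_numer 2 I s a)"
  define X where "X = [:0, 1:: real:]"
  define L where "L = X ^ 2 * N u * N v + smult c (D * N v) + X * N v * N w"
  define M where "M = X * N w * D"
  have m: "m \<ge> 1"
    using assms(1,2) by (simp add: m_def Suc_le_eq card_gt_0_iff)
  have degN: "degree (N a) \<le> 2 * m - 2" for a
    using degree_pf_numer[OF assms(1), of 2 s a] by (simp add: N_def m_def diff_mult_distrib2)
  have degD: "degree D = 2 * m"
    by (simp add: D_def m_def degree_pf_denom)
  have degX: "degree X = 1" "degree (X ^ 2) = 2"
    by (simp_all add: X_def degree_linear_power)
  have "degree (X ^ 2 * N u * N v) \<le> 2 + (2 * m - 2) + (2 * m - 2)"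
    using degree_mult_le[of "X ^ 2 * N u" "N v"] degree_mult_le[of "X ^ 2" "N u"]
      degN[of u] degN[of v] degX by linarith
  moreover have "degree (smult c (D * N v)) \<le> 2 * m + (2 * m - 2)"
    using degree_smult_le[of c "D * N v"] degree_mult_le[of D "N v"] degN[of v] degD by linarith
  moreover have "degree (X * N v * N w) \<le> 1 + (2 * m - 2) + (2 * m - 2)"
    using degree_mult_le[of "X * N v" "N w"] degree_mult_le[of X "N v"]
      degN[of v] degN[of w] degX by linarith
  ultimately have "degree L \<le> 4 * m - 2"
    unfolding L_def using m by (intro degree_add_le) auto
  moreover have "degree M = 4 * m - 1"
  proof -
    have "poly.coeff (N w) (2 * m - 2) \<noteq> 0"
      using coeff_pf_numer[OF assms(1), of 2 s w] w by (simp add: N_def m_def diff_mult_distrib2)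
    then have "degree (N w) = 2 * m - 2" "N w \<noteq> 0"
      using degN[of w] le_degree[of "N w"] by (force intro: antisym)+
    moreover have "X \<noteq> 0" "D \<noteq> 0"
      by (simp_all add: X_def D_def pf_denom_nonzero)
    ultimately have "degree M = 1 + (2 * m - 2) + 2 * m"
      by (simp add: M_def degree_mult_eq degX degD)
    with m show ?thesis by simp
  qed
  ultimately have deg: "degree (L - M) = 4 * m - 1"
    using m degree_add_eq_right[of L "- M"] by simp
  with m have nz: "L - M \<noteq> 0"
    by auto
  have "poly (L - M) k = 0" if "k \<in> S" for k
  proof -
    have "poly (N a) k = poly D k * f a k" for a
      using that poly_pf_numer[OF assms(1), of s k 2 a] by (simp add: S_def N_def D_def f_def)
    then have "poly (L - M) k
        = (poly D k)\<^sup>2 * ((k\<^sup>2 * f u k + c) * f v k - (1 - f v k) * k * f w k)"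
      by (simp add: L_def M_def X_def power2_eq_square algebra_simps)
    with that show ?thesis
      by (simp add: S_def)
  qed
  then have sub: "S \<subseteq> {k. poly (L - M) k = 0}"
    by blast
  show "finite S"
    using sub poly_roots_finite[OF nz] by (rule finite_subset)
  show "card S \<le> 4 * card (s ` I) - 1"
    using card_mono[OF poly_roots_finite[OF nz] sub] card_poly_roots_bound[OF nz] deg
    by (simp add: m_def)
qed

section \<open>The fixed-point equation\<close>

text \<open>The penalty as a function of the effective regularization \<open>k\<close>: the fixed-point equation
  solved for \<open>l\<close>.\<close>

definition penalty :: "nat \<Rightarrow> ('i::finite \<Rightarrow> real) \<Rightarrow> real \<Rightarrow> real" where
  "penalty n s k = k - (\<Sum>i\<in>UNIV. k * s i / (s i + k)) / real n"

lemma penalty_factor: "penalty n s k = k * (1 - (\<Sum>i\<in>UNIV. s i / (s i + k)) / real n)"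
  by (simp add: penalty_def algebra_simps sum_distrib_left)

lemma penalty_lower_bound:
  fixes s :: "'i::finite \<Rightarrow> real"
  assumes "\<And>i. 0 < s i" and "0 < k"
  shows "k - (\<Sum>i\<in>UNIV. s i) / real n \<le> penalty n s k"
proof -
  have "k * s i / (s i + k) \<le> s i" for i
    using assms(1)[of i] assms(2) by (simp add: field_simps)
  then show ?thesis
    by (auto simp: penalty_def intro!: divide_right_mono sum_mono)
qed

text \<open>Where it is positive, \<open>penalty\<close> is the product of \<open>k\<close> and a positive increasing factor.\<close>

lemma penalty_strict_mono:
  fixes s :: "'i::finite \<Rightarrow> real"
  assumes s: "\<And>i. 0 < s i" and "0 < k" and "k < k'" and pos: "0 < penalty n s k"
  shows "penalty n s k < penalty n s k'"
proof -
  let ?h = "\<lambda>k. 1 - (\<Sum>i\<in>UNIV. s i / (s i + k)) / real n"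
  have "s i / (s i + k') \<le> s i / (s i + k)" for i
    using s[of i] assms(2,3) by (intro divide_left_mono) auto
  then have le: "?h k \<le> ?h k'"
    by (auto intro!: divide_right_mono sum_mono)
  have "0 < ?h k"
    using pos assms(2) unfolding penalty_factor by (simp add: zero_less_mult_iff)
  then have "k * ?h k < k' * ?h k"
    using assms(3) by simp
  also have "\<dots> \<le> k' * ?h k'"
    using le assms(2,3) by (intro mult_left_mono) auto
  finally show ?thesis
    by (simp only: penalty_factor)
qed

lemma penalty_solution_exists:
  fixes s :: "'i::finite \<Rightarrow> real"
  assumes s: "\<And>i. 0 < s i" and l: "0 < l"
  shows "\<exists>k>0. penalty n s k = l"
proof -
  define b where "b = l + (\<Sum>i\<in>UNIV. s i) / real n"
  have S: "0 \<le> (\<Sum>i\<in>UNIV. s i) / real n"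
    using s by (intro divide_nonneg_nonneg sum_nonneg) (auto simp: less_imp_le)
  have "l \<le> penalty n s b"
    using penalty_lower_bound[of s b n] s l S by (simp add: b_def)
  moreover have "penalty n s 0 \<le> l"
    using l by (simp add: penalty_def)
  moreover have "0 \<le> b"
    using l S by (simp add: b_def)
  moreover have "continuous_on {0..b} (penalty n s)"
  proof -
    have "s i + k \<noteq> 0" if "k \<in> {0..b}" for i k
      using that s[of i] by auto
    then show ?thesis
      unfolding penalty_def by (cases "n = 0") (auto intro!: continuous_intros)
  qed
  ultimately obtain k where k: "0 \<le> k" "penalty n s k = l"
    using IVT'[of "penalty n s" 0 l b] by blast
  have "k \<noteq> 0"
    using k l by (auto simp: penalty_def)
  with k have "0 < k"
    by simp
  with k(2) show ?thesis
    by blast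
qed

section \<open>Matrices diagonalized by a fixed orthogonal matrix\<close>

definition spectral :: "real ^ 'p ^ 'p \<Rightarrow> ('p \<Rightarrow> real) \<Rightarrow> real ^ 'p ^ 'p" where
  "spectral U f = transpose U ** diag_matrix (\<chi> i. f i) ** U"

lemma diag_matrix_mult_vec: "(diag_matrix a *v x) $ i = a $ i * x $ i"
  by (simp add: diag_matrix_def matrix_vector_mult_def if_distrib[of "\<lambda>x. x * _"] sum.delta cong: if_cong)

lemma diag_matrix_mult: "diag_matrix a ** diag_matrix b = diag_matrix (\<chi> i. a $ i * b $ i)"
  by (simp add: matrix_eq vec_eq_iff diag_matrix_mult_vec flip: matrix_vector_mul_assoc)

context
  fixes U :: "real ^ 'p ^ 'p"
  assumes U: "orthogonal_matrix U"
begin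

(* rewriting transpose U *v x to x v* U would block the cancellation against U *)
declare transpose_matrix_vector [simp del]

lemma UtU: "transpose U ** U = mat 1" and UUt: "U ** transpose U = mat 1"
  using U by (simp_all add: orthogonal_matrix_def)

lemma U_transpose_vec: "U *v (transpose U *v x) = x"
  by (simp add: matrix_vector_mul_assoc UUt)

lemma spectral_one: "spectral U (\<lambda>i. 1) = mat 1"
proof -
  have "diag_matrix (\<chi> i. 1) = (mat 1 :: real ^ 'p ^ 'p)"
    by (simp add: diag_matrix_def mat_def vec_eq_iff)
  then show ?thesis
    by (simp add: spectral_def UtU)
qed

lemma spectral_mult: "spectral U f ** spectral U g = spectral U (\<lambda>i. f i * g i)"
proof -
  have "spectral U f ** spectral U g
      = transpose U ** diag_matrix (\<chi> i. f i) ** (U ** transpose U) ** diag_matrix (\<chi> i. g i) ** U"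
    by (simp add: spectral_def matrix_mul_assoc)
  also have "\<dots> = transpose U ** (diag_matrix (\<chi> i. f i) ** diag_matrix (\<chi> i. g i)) ** U"
    by (simp add: UUt matrix_mul_assoc)
  finally show ?thesis
    by (simp add: spectral_def diag_matrix_mult)
qed

lemma spectral_add: "spectral U f + spectral U g = spectral U (\<lambda>i. f i + g i)"
proof -
  have "diag_matrix (\<chi> i. f i + g i) = diag_matrix (\<chi> i. f i) + diag_matrix (\<chi> i. g i)"
    by (simp add: diag_matrix_def vec_eq_iff)
  then show ?thesis
    by (simp add: spectral_def matrix_add_ldistrib matrix_eq matrix_vector_mult_add_rdistrib
        matrix_vector_right_distrib flip: matrix_vector_mul_assoc)
qed

lemma spectral_mult_vec: "U *v (spectral U f *v x) = (\<chi> i. f i * (U *v x) $ i)"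
proof -
  have "U *v (spectral U f *v x) = diag_matrix (\<chi> i. f i) *v (U *v x)"
    by (simp add: spectral_def matrix_vector_mul_assoc matrix_mul_assoc UUt)
  then show ?thesis
    by (simp add: vec_eq_iff diag_matrix_mult_vec)
qed

lemma matpow_spectral: "matpow (spectral U f) k = spectral U (\<lambda>i. f i ^ k)"
  by (induction k) (simp_all add: spectral_one spectral_mult)

lemma mat_eq_spectral: "mat k = spectral U (\<lambda>i. k)"
proof -
  have "spectral U (\<lambda>i. k) *v x = mat k *v x" for x
  proof -
    have "U *v (spectral U (\<lambda>i. k) *v x) = U *v (mat k *v x)"
    proof -
      have "mat k *v x = k *\<^sub>R x"
        by (simp add: vec_eq_iff mat_def matrix_vector_mult_def if_distrib[of "\<lambda>x. x * _"]
            sum.delta cong: if_cong)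
      then have "U *v (mat k *v x) = k *\<^sub>R (U *v x)"
        by (simp only: matrix_vector_mult_scaleR)
      then show ?thesis
        by (simp add: spectral_mult_vec vec_eq_iff)
    qed
    then have "transpose U *v (U *v (spectral U (\<lambda>i. k) *v x)) = transpose U *v (U *v (mat k *v x))"
      by simp
    then show ?thesis
      by (simp add: matrix_vector_mul_assoc matrix_mul_assoc UtU)
  qed
  then show ?thesis
    by (simp add: matrix_eq)
qed

lemma trace_spectral: "trace (spectral U f) = (\<Sum>i\<in>UNIV. f i)"
proof -
  have "trace (spectral U f) = trace (U ** (transpose U ** diag_matrix (\<chi> i. f i)))"
    unfolding spectral_def by (rule trace_mul_sym)
  also have "\<dots> = trace (diag_matrix (\<chi> i. f i))"
    by (simp add: matrix_mul_assoc UUt)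
  finally show ?thesis
    by (simp add: trace_def diag_matrix_def)
qed

lemma inner_spectral: "x \<bullet> (spectral U f *v x) = (\<Sum>i\<in>UNIV. f i * ((U *v x) $ i)\<^sup>2)"
proof -
  have "x \<bullet> (transpose U *v y) = (U *v x) \<bullet> y" for y
    by (metis dot_lmul_matrix vector_transpose_matrix)
  then have "x \<bullet> (spectral U f *v x) = (U *v x) \<bullet> (diag_matrix (\<chi> i. f i) *v (U *v x))"
    by (simp add: spectral_def flip: matrix_vector_mul_assoc)
  then show ?thesis
    by (simp add: inner_vec_def diag_matrix_mult_vec power2_eq_square mult_ac)
qed

lemma resolvent_spectral:
  assumes "\<And>i. f i + k \<noteq> 0"
  shows "resolvent (spectral U f) k = spectral U (\<lambda>i. inverse (f i + k))"
proof -
  let ?A = "spectral U f + mat k" and ?B = "spectral U (\<lambda>i. inverse (f i + k))"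
  have A: "?A = spectral U (\<lambda>i. f i + k)"
    by (simp add: mat_eq_spectral spectral_add)
  have inv: "?A ** ?B = mat 1" "?B ** ?A = mat 1"
    using assms by (simp_all add: A spectral_mult spectral_one)
  have "?A ** matrix_inv ?A = mat 1 \<and> matrix_inv ?A ** ?A = mat 1"
    unfolding matrix_inv_def by (rule someI[of _ ?B]) (use inv in simp)
  then have "matrix_inv ?A = ?B"
    by (metis inv(2) matrix_mul_assoc matrix_mul_lid matrix_mul_rid)
  then show ?thesis
    by (simp add: resolvent_def)
qed

lemma eigenvalues_spectral: "eigenvalues (spectral U f) = range f"
proof (intro set_eqI iffI)
  fix e assume "e \<in> eigenvalues (spectral U f)"
  then obtain x where x: "x \<noteq> 0" "spectral U f *v x = e *\<^sub>R x"
    by (auto simp: eigenvalues_def)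
  have "U *v x \<noteq> 0"
  proof
    assume "U *v x = 0"
    then have "transpose U *v (U *v x) = 0"
      by simp
    with x(1) show False
      by (simp add: matrix_vector_mul_assoc UtU)
  qed
  then obtain i where i: "(U *v x) $ i \<noteq> 0"
    by (auto simp: vec_eq_iff)
  have "U *v (spectral U f *v x) = e *\<^sub>R (U *v x)"
    by (simp add: x(2) matrix_vector_mult_scaleR)
  then have "f i * (U *v x) $ i = e * (U *v x) $ i"
    by (simp add: spectral_mult_vec vec_eq_iff)
  with i show "e \<in> range f"
    by auto
next
  fix e assume "e \<in> range f"
  then obtain i where e: "e = f i"
    by auto
  define x where "x = transpose U *v axis i (1 :: real)"
  have Ux: "U *v x = axis i 1"
    by (simp add: x_def U_transpose_vec)
  then have "x \<noteq> 0"
    by (auto simp: axis_eq_0_iff)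
  moreover have "spectral U f *v x = e *\<^sub>R x"
  proof -
    have "U *v (spectral U f *v x) = U *v (e *\<^sub>R x)"
      by (simp add: spectral_mult_vec Ux matrix_vector_mult_scaleR vec_eq_iff axis_def e)
    then have "transpose U *v (U *v (spectral U f *v x)) = transpose U *v (U *v (e *\<^sub>R x))"
      by simp
    then show ?thesis
      by (simp add: matrix_vector_mul_assoc matrix_mul_assoc UtU)
  qed
  ultimately show "e \<in> eigenvalues (spectral U f)"
    by (auto simp: eigenvalues_def)
qed

lemma pos_def_spectral:
  assumes "pos_def_matrix (spectral U f)"
  shows "0 < f i"
proof -
  define x where "x = transpose U *v axis i (1 :: real)"
  have Ux: "U *v x = axis i 1"
    by (simp add: x_def U_transpose_vec)
  then have "x \<noteq> 0"
    by (auto simp: axis_eq_0_iff)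
  with assms have "0 < x \<bullet> (spectral U f *v x)"
    by (simp add: pos_def_matrix_def)
  also have "\<dots> = f i"
    by (simp add: inner_spectral Ux axis_def if_distrib[of "\<lambda>x. x\<^sup>2"] if_distrib[of "\<lambda>x. _ * x"]
        sum.delta cong: if_cong)
  finally show ?thesis .
qed

text \<open>The dimension \<open>p\<close> cancels between the aspect ratio and the normalized trace.\<close>

lemma aspect_ntrace_spectral:
  fixes A :: "real ^ 'p ^ 'p"
  shows "aspect n A * ntrace (spectral U f) = (\<Sum>i\<in>UNIV. f i) / real n"
  by (simp add: aspect_def ntrace_def trace_spectral)

lemma kappa_equation_iff:
  assumes "\<And>i. 0 < f i" and "0 < k"
  shows "k = l + aspect n (spectral U f) * k * ntrace (spectral U f ** resolvent (spectral U f) k)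
    \<longleftrightarrow> penalty n f k = l"
proof -
  have nz: "f i + k \<noteq> 0" for i
    using assms(1)[of i] assms(2) by auto
  have "aspect n (spectral U f) * k * ntrace (spectral U f ** resolvent (spectral U f) k)
      = k * (aspect n (spectral U f) * ntrace (spectral U (\<lambda>i. f i * inverse (f i + k))))"
    by (simp add: resolvent_spectral[OF nz] spectral_mult)
  also have "\<dots> = (\<Sum>i\<in>UNIV. k * f i / (f i + k)) / real n"
    by (simp add: aspect_ntrace_spectral sum_distrib_left divide_inverse mult.assoc)
  finally show ?thesis
    by (auto simp: penalty_def)
qed

lemma kappa_eq_iff:
  assumes f: "\<And>i. 0 < f i" and l: "0 < l"
  shows "kappa n (spectral U f) l = k \<longleftrightarrow> 0 < k \<and> penalty n f k = l"
proof -
  have uniq: "k = k'" if "0 < k" "penalty n f k = l" "0 < k'" "penalty n f k' = l" for k k'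
    using penalty_strict_mono[of f k k' n] penalty_strict_mono[of f k' k n] that f l
    by (cases k k' rule: linorder_cases) auto
  obtain k' where k': "0 < k'" "penalty n f k' = l"
    using penalty_solution_exists[of f l n] f l by auto
  have "kappa n (spectral U f) l = (THE k. 0 < k \<and> penalty n f k = l)"
    unfolding kappa_def by (intro arg_cong[of _ _ The] ext conj_cong[OF refl] kappa_equation_iff f)
  also have "\<dots> = k'"
    using k' uniq by (intro the_equality) auto
  finally show ?thesis
    using k' uniq by blast
qed

section \<open>The gap between risk and correlation\<close>

lemma qform_spectral:
  "qform (spectral U f) \<beta> (spectral U g) (spectral U h) i j
    = (\<Sum>k\<in>UNIV. f k * g k ^ i * h k ^ j * ((U *v \<beta>) $ k)\<^sup>2)"
  by (simp add: qform_def matpow_spectral spectral_mult inner_spectral mult_ac)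

lemma tform_spectral:
  "tform n (spectral U f) (spectral U g) (spectral U h) i j
    = (\<Sum>k\<in>UNIV. (f k)\<^sup>2 * g k ^ i * h k ^ j) / real n"
  by (simp only: tform_def matpow_spectral spectral_mult aspect_ntrace_spectral)

text \<open>Per coordinate, \<open>- \<kappa>\<^sub>t v \<sigma> / (\<sigma> + \<kappa>\<^sub>t) + \<kappa>\<^sub>t\<^sup>2 v \<sigma> / (\<sigma> + \<kappa>\<^sub>t)\<^sup>2\<close> collapses to
  \<open>- \<kappa>\<^sub>t v \<sigma>\<^sup>2 / (\<sigma> + \<kappa>\<^sub>t)\<^sup>2\<close>, which has the same prefactor as the trace terms; this is where the
  coefficients \<open>c\<^sub>k\<close> come from.\<close>

lemma risk_gap:
  assumes s: "\<And>i. 0 < s $ i" and s': "\<And>i. 0 < s' $ i" and l\<^sub>t: "0 < l\<^sub>t" and l\<^sub>s: "0 < l\<^sub>s"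
  defines "\<Sigma>\<^sub>t \<equiv> spectral U (($) s)" and "\<Sigma>\<^sub>s \<equiv> spectral U (($) s')"
  shows "teacher_risk n\<^sub>t \<Sigma>\<^sub>t \<beta> \<sigma>2 l\<^sub>t - residual_corr n\<^sub>t n\<^sub>s \<Sigma>\<^sub>t \<Sigma>\<^sub>s \<beta> \<sigma>2 l\<^sub>t l\<^sub>s
    = kappa n\<^sub>s \<Sigma>\<^sub>s l\<^sub>s *
      (\<Sum>k\<in>UNIV. c_coeff n\<^sub>t \<Sigma>\<^sub>t \<beta> \<sigma>2 U s l\<^sub>t k / (s' $ k + kappa n\<^sub>s \<Sigma>\<^sub>s l\<^sub>s))"
proof -
  define x where "x = kappa n\<^sub>t \<Sigma>\<^sub>t l\<^sub>t"
  define y where "y = kappa n\<^sub>s \<Sigma>\<^sub>s l\<^sub>s"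
  define b where "b = b_teacher n\<^sub>t \<Sigma>\<^sub>t l\<^sub>t"
  define Q where "Q = qform \<Sigma>\<^sub>t \<beta> (resolvent \<Sigma>\<^sub>t x) (mat 1) 2 0"
  have x: "0 < x" and y: "0 < y"
    using kappa_eq_iff[of "($) s" l\<^sub>t n\<^sub>t x] kappa_eq_iff[of "($) s'" l\<^sub>s n\<^sub>s y] s s' l\<^sub>t l\<^sub>s
    by (simp_all add: x_def y_def \<Sigma>\<^sub>t_def \<Sigma>\<^sub>s_def)
  have nzx: "s $ i + x \<noteq> 0" and nzy: "s' $ i + y \<noteq> 0" for i
    using s[of i] s'[of i] x y by auto
  define g h where "g = (\<lambda>i. inverse (s $ i + x))" and "h = (\<lambda>i. inverse (s' $ i + y))"
  have Gt: "resolvent \<Sigma>\<^sub>t x = spectral U g" and Gs: "resolvent \<Sigma>\<^sub>s y = spectral U h"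
    by (simp_all add: \<Sigma>\<^sub>t_def \<Sigma>\<^sub>s_def g_def h_def resolvent_spectral nzx nzy)
  let ?v = "\<lambda>k. ((U *v \<beta>) $ k)\<^sup>2"
  define A where "A = (x\<^sup>2 * b * Q + \<sigma>2 * b) / real n\<^sub>t"
  have "qform \<Sigma>\<^sub>t \<beta> (spectral U g) (spectral U h) 2 0 = Q"
    unfolding Q_def Gt by (rule qform_0_right)
  then have "teacher_risk n\<^sub>t \<Sigma>\<^sub>t \<beta> \<sigma>2 l\<^sub>t - residual_corr n\<^sub>t n\<^sub>s \<Sigma>\<^sub>t \<Sigma>\<^sub>s \<beta> \<sigma>2 l\<^sub>t l\<^sub>s
    = y * (- x * qform \<Sigma>\<^sub>t \<beta> (spectral U g) (spectral U h) 1 1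
        + x\<^sup>2 * qform \<Sigma>\<^sub>t \<beta> (spectral U g) (spectral U h) 2 1
        + (x\<^sup>2 * b * Q + \<sigma>2 * b) * tform n\<^sub>t \<Sigma>\<^sub>t (spectral U g) (spectral U h) 2 1)"
    by (simp add: residual_corr_def Let_def Gt Gs flip: x_def y_def b_def) (simp add: algebra_simps)
  also have "\<dots> = y * ((\<Sum>k\<in>UNIV. - x * (s $ k * g k * h k * ?v k))
      + (\<Sum>k\<in>UNIV. x\<^sup>2 * (s $ k * (g k)\<^sup>2 * h k * ?v k))
      + (\<Sum>k\<in>UNIV. A * ((s $ k)\<^sup>2 * (g k)\<^sup>2 * h k)))"
    unfolding \<Sigma>\<^sub>t_def qform_spectral tform_spectral by (simp add: A_def sum_distrib_left sum_divide_distrib)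
  also have "\<dots> = y * (\<Sum>k\<in>UNIV. - x * (s $ k * g k * h k * ?v k)
      + x\<^sup>2 * (s $ k * (g k)\<^sup>2 * h k * ?v k) + A * ((s $ k)\<^sup>2 * (g k)\<^sup>2 * h k))"
    by (simp only: sum.distrib)
  also have "\<dots> = y * (\<Sum>k\<in>UNIV. c_coeff n\<^sub>t \<Sigma>\<^sub>t \<beta> \<sigma>2 U s l\<^sub>t k / (s' $ k + y))"
  proof -
    have "- x * (s $ k * g k * h k * ?v k) + x\<^sup>2 * (s $ k * (g k)\<^sup>2 * h k * ?v k)
        + A * ((s $ k)\<^sup>2 * (g k)\<^sup>2 * h k) = c_coeff n\<^sub>t \<Sigma>\<^sub>t \<beta> \<sigma>2 U s l\<^sub>t k / (s' $ k + y)" for k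
    proof -
      have "g k = (s $ k + x) * (g k)\<^sup>2"
        using nzx[of k] by (simp add: g_def power2_eq_square)
      then have "- x * (s $ k * g k * h k * ?v k) + x\<^sup>2 * (s $ k * (g k)\<^sup>2 * h k * ?v k)
          + A * ((s $ k)\<^sup>2 * (g k)\<^sup>2 * h k)
        = - x * (s $ k * ((s $ k + x) * (g k)\<^sup>2) * h k * ?v k)
          + x\<^sup>2 * (s $ k * (g k)\<^sup>2 * h k * ?v k) + A * ((s $ k)\<^sup>2 * (g k)\<^sup>2 * h k)"
        by simp
      also have "\<dots> = (s $ k)\<^sup>2 * (g k)\<^sup>2 * (A - x * ?v k) * h k"
        by (simp add: algebra_simps power2_eq_square)
      also have "\<dots> = x * (s $ k)\<^sup>2 * (g k)\<^sup>2 * (A / x - ?v k) * h k"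
        using x by (simp add: field_simps)
      also have "\<dots> = c_coeff n\<^sub>t \<Sigma>\<^sub>t \<beta> \<sigma>2 U s l\<^sub>t k / (s' $ k + y)"
        by (simp add: c_coeff_def Let_def A_def g_def h_def power_inverse divide_inverse Q_def mult_ac
            flip: x_def b_def)
      finally show ?thesis .
    qed
    then show ?thesis by simp
  qed
  finally show ?thesis
    by (simp add: y_def)
qed

text \<open>The \<open>c\<^sub>k\<close> that share an eigenvalue of \<open>\<Sigma>\<^sub>s\<close> share a pole in \<open>\<kappa>\<^sub>s\<close>, so that only
  their sums can be read off from the gap.\<close>

lemma mem_Lambda_t_iff:
  assumes s: "\<And>i. 0 < s $ i" and s': "\<And>i. 0 < s' $ i" and l\<^sub>t: "0 < l\<^sub>t"
  defines "\<Sigma>\<^sub>t \<equiv> spectral U (($) s)" and "\<Sigma>\<^sub>s \<equiv> spectral U (($) s')"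
  shows "l\<^sub>t \<in> Lambda_t n\<^sub>t n\<^sub>s \<Sigma>\<^sub>t \<Sigma>\<^sub>s \<beta> \<sigma>2 \<longleftrightarrow>
    (\<forall>e\<in>range (($) s'). (\<Sum>k | s' $ k = e. c_coeff n\<^sub>t \<Sigma>\<^sub>t \<beta> \<sigma>2 U s l\<^sub>t k) = 0)"
    (is "_ \<longleftrightarrow> (\<forall>e\<in>_. ?d e = 0)")
proof -
  let ?c = "c_coeff n\<^sub>t \<Sigma>\<^sub>t \<beta> \<sigma>2 U s l\<^sub>t"
  let ?E = "range (($) s')"
  have group: "(\<Sum>k\<in>UNIV. ?c k / (s' $ k + y)) = (\<Sum>e\<in>?E. ?d e / (e + y))" for y
  proof -
    have "(\<Sum>k\<in>UNIV. ?c k / (s' $ k + y)) = (\<Sum>e\<in>?E. \<Sum>k | s' $ k = e. ?c k / (s' $ k + y))"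
      using sum.group[of UNIV ?E "($) s'" "\<lambda>k. ?c k / (s' $ k + y)"] by simp
    also have "\<dots> = (\<Sum>e\<in>?E. ?d e / (e + y))"
      by (simp add: sum_divide_distrib)
    finally show ?thesis .
  qed
  have gap: "teacher_risk n\<^sub>t \<Sigma>\<^sub>t \<beta> \<sigma>2 l\<^sub>t - residual_corr n\<^sub>t n\<^sub>s \<Sigma>\<^sub>t \<Sigma>\<^sub>s \<beta> \<sigma>2 l\<^sub>t l\<^sub>s
      = kappa n\<^sub>s \<Sigma>\<^sub>s l\<^sub>s * (\<Sum>e\<in>?E. ?d e / (e + kappa n\<^sub>s \<Sigma>\<^sub>s l\<^sub>s))" if "0 < l\<^sub>s" for l\<^sub>s
    using risk_gap[of s s' l\<^sub>t l\<^sub>s] s s' l\<^sub>t that unfolding \<Sigma>\<^sub>t_def \<Sigma>\<^sub>s_def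
    by (simp add: group[unfolded \<Sigma>\<^sub>t_def])
  show ?thesis
  proof
    assume mem: "l\<^sub>t \<in> Lambda_t n\<^sub>t n\<^sub>s \<Sigma>\<^sub>t \<Sigma>\<^sub>s \<beta> \<sigma>2"
    \<comment> \<open>Beyond this bound every \<open>y\<close> is the effective regularization of some positive penalty.\<close>
    define B where "B = max 0 ((\<Sum>i\<in>UNIV. s' $ i) / real n\<^sub>s)"
    have zero: "(\<Sum>e\<in>?E. ?d e / (e + y)) = 0" if "y \<in> {B<..}" for y
    proof -
      have y: "0 < y" "(\<Sum>i\<in>UNIV. s' $ i) / real n\<^sub>s < y"
        using that by (auto simp: B_def)
      then have l: "0 < penalty n\<^sub>s (($) s') y"
        using penalty_lower_bound[of "($) s'" y n\<^sub>s] s' by simp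
      then have "kappa n\<^sub>s \<Sigma>\<^sub>s (penalty n\<^sub>s (($) s') y) = y"
        using kappa_eq_iff[of "($) s'"] s' y by (simp add: \<Sigma>\<^sub>s_def)
      then show ?thesis
        using gap[OF l] mem l y by (simp add: Lambda_t_def)
    qed
    show "\<forall>e\<in>?E. ?d e = 0"
    proof
      fix e assume e: "e \<in> ?E"
      show "?d e = 0"
      proof (rule partial_fractions_independent[of ?E "{B<..}" ?d])
        show "e + x \<noteq> 0" if "e \<in> ?E" "x \<in> {B<..}" for e x
        proof -
          have "0 < e" "0 < x"
            using that s' by (auto simp: B_def)
          then show ?thesis by simp
        qed
      qed (use e zero in \<open>auto simp: infinite_Ioi\<close>)
    qed
  next
    assume zero: "\<forall>e\<in>?E. ?d e = 0"
    have "(\<Sum>e\<in>?E. ?d e / (e + y)) = 0" for y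
      by (rule sum.neutral) (use zero in auto)
    then show "l\<^sub>t \<in> Lambda_t n\<^sub>t n\<^sub>s \<Sigma>\<^sub>t \<Sigma>\<^sub>s \<beta> \<sigma>2"
      using gap l\<^sub>t unfolding Lambda_t_def by auto
  qed
qed

section \<open>The cardinality bound\<close>

text \<open>Positivity of the penalty bounds \<open>t\<^sub>2\<^sub>,\<^sub>0\<close> by one, since
  \<open>(\<sigma> / (\<sigma> + k))\<^sup>2 \<le> \<sigma> / (\<sigma> + k)\<close>; so \<open>b\<^sub>t\<close> is a genuine reciprocal.\<close>

lemma penalty_pos_imp_t_less_1:
  fixes s :: "'i::finite \<Rightarrow> real"
  assumes s: "\<And>i. 0 < s i" and k: "0 < k" and pos: "0 < penalty n s k"
  shows "(\<Sum>i\<in>UNIV. (s i)\<^sup>2 / (s i + k)\<^sup>2) / real n < 1"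
proof -
  have "(s i)\<^sup>2 / (s i + k)\<^sup>2 \<le> s i / (s i + k)" for i
  proof -
    have "(s i / (s i + k))\<^sup>2 \<le> s i / (s i + k)"
      using s[of i] k power_decreasing[of 1 2 "s i / (s i + k)"] by simp
    then show ?thesis
      by (simp add: power_divide)
  qed
  then have "(\<Sum>i\<in>UNIV. (s i)\<^sup>2 / (s i + k)\<^sup>2) / real n \<le> (\<Sum>i\<in>UNIV. s i / (s i + k)) / real n"
    by (auto intro!: divide_right_mono sum_mono)
  also have "\<dots> < 1"
    using pos k unfolding penalty_factor by (simp add: zero_less_mult_iff)
  finally show ?thesis .
qed

text \<open>The necessary condition behind the bound: the sum of all \<open>d\<^sub>j\<close> vanishes, multiplied by
  \<open>1 - t\<^sub>2\<^sub>,\<^sub>0\<close> to clear \<open>b\<^sub>t\<close>.\<close>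

lemma balance_equation:
  assumes n\<^sub>t: "0 < n\<^sub>t" and s: "\<And>i. 0 < s $ i" and s': "\<And>i. 0 < s' $ i"
    and mem: "l \<in> Lambda_t n\<^sub>t n\<^sub>s (spectral U (($) s)) (spectral U (($) s')) \<beta> \<sigma>2"
  defines "k \<equiv> kappa n\<^sub>t (spectral U (($) s)) l"
    and "f \<equiv> \<lambda>a k. \<Sum>i\<in>UNIV. a i / (s $ i + k)\<^sup>2"
    and "v \<equiv> \<lambda>i. ((U *v \<beta>) $ i)\<^sup>2"
  shows "(k\<^sup>2 * f (\<lambda>i. s $ i * v i) k + \<sigma>2) * f (\<lambda>i. (s $ i)\<^sup>2 / real n\<^sub>t) k
    = (1 - f (\<lambda>i. (s $ i)\<^sup>2 / real n\<^sub>t) k) * k * f (\<lambda>i. (s $ i)\<^sup>2 * v i) k"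
proof -
  let ?S = "spectral U (($) s)"
  define q t w where "q = f (\<lambda>i. s $ i * v i) k" and "t = f (\<lambda>i. (s $ i)\<^sup>2 / real n\<^sub>t) k"
    and "w = f (\<lambda>i. (s $ i)\<^sup>2 * v i) k"
  have l: "0 < l"
    using mem by (simp add: Lambda_t_def)
  have k: "0 < k" "penalty n\<^sub>t (($) s) k = l"
    using kappa_eq_iff[of "($) s" l n\<^sub>t k] s l by (simp_all add: k_def)
  have nz: "s $ i + k \<noteq> 0" for i
    using s[of i] k by auto
  have one: "mat 1 = spectral U (\<lambda>i. 1)"
    by (rule mat_eq_spectral)
  have G: "resolvent ?S k = spectral U (\<lambda>i. inverse (s $ i + k))"
    by (simp add: resolvent_spectral nz)
  have q: "qform ?S \<beta> (resolvent ?S k) (mat 1) 2 0 = q"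
    unfolding G one qform_spectral
    by (simp add: q_def f_def v_def divide_inverse power_inverse mult_ac)
  have t: "tform n\<^sub>t ?S (resolvent ?S k) (mat 1) 2 0 = t"
    unfolding G one tform_spectral
    by (simp add: t_def f_def divide_inverse power_inverse sum_distrib_left mult_ac)
  have "t = (\<Sum>i\<in>UNIV. (s $ i)\<^sup>2 / (s $ i + k)\<^sup>2) / real n\<^sub>t"
    by (simp add: t_def f_def sum_divide_distrib mult.commute)
  then have t1: "t < 1"
    using penalty_pos_imp_t_less_1[of "($) s" k n\<^sub>t] s k l by simp
  have b: "b_teacher n\<^sub>t ?S l = inverse (1 - t)"
    using t by (simp add: b_teacher_def k_def)
  define A where "A = (k\<^sup>2 * q + \<sigma>2) / (1 - t)"
  have c: "c_coeff n\<^sub>t ?S \<beta> \<sigma>2 U s l i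
      = A * ((s $ i)\<^sup>2 / real n\<^sub>t / (s $ i + k)\<^sup>2) - k * ((s $ i)\<^sup>2 * v i / (s $ i + k)\<^sup>2)" for i
  proof -
    have "c_coeff n\<^sub>t ?S \<beta> \<sigma>2 U s l i
        = k * (s $ i)\<^sup>2 / (s $ i + k)\<^sup>2 * (A / (k * real n\<^sub>t) - v i)"
      by (simp add: c_coeff_def Let_def b q A_def v_def divide_inverse algebra_simps flip: k_def)
    also have "\<dots> = A * ((s $ i)\<^sup>2 / real n\<^sub>t / (s $ i + k)\<^sup>2) - k * ((s $ i)\<^sup>2 * v i / (s $ i + k)\<^sup>2)"
      using k n\<^sub>t nz[of i] by (simp add: right_diff_distrib diff_divide_distrib mult_ac)
    finally show ?thesis .
  qed
  have "(\<Sum>i\<in>UNIV. c_coeff n\<^sub>t ?S \<beta> \<sigma>2 U s l i)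
      = (\<Sum>e\<in>range (($) s'). \<Sum>i | s' $ i = e. c_coeff n\<^sub>t ?S \<beta> \<sigma>2 U s l i)"
    using sum.group[of UNIV "range (($) s')" "($) s'" "c_coeff n\<^sub>t ?S \<beta> \<sigma>2 U s l"] by simp
  also have "\<dots> = 0"
    by (rule sum.neutral) (use mem mem_Lambda_t_iff[of s s' l n\<^sub>t n\<^sub>s \<beta> \<sigma>2] s s' l in auto)
  finally have "A * t - k * w = 0"
    by (simp add: c t_def w_def f_def sum_subtractf sum_distrib_left)
  then have "(1 - t) * (A * t) = (1 - t) * (k * w)"
    by simp
  moreover have "(1 - t) * A = k\<^sup>2 * q + \<sigma>2"
    using t1 by (simp add: A_def)
  ultimately have "(k\<^sup>2 * q + \<sigma>2) * t = (1 - t) * k * w"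
    by (metis mult.assoc)
  then show ?thesis
    by (simp only: q_def t_def w_def)
qed

lemma card_Lambda_t:
  fixes n\<^sub>s :: nat
  assumes n\<^sub>t: "0 < n\<^sub>t" and s: "\<And>i. 0 < s $ i" and s': "\<And>i. 0 < s' $ i" and "0 \<le> \<sigma>2"
    and nontrivial: "0 < (norm \<beta>)\<^sup>2 + \<sigma>2"
  defines "\<Lambda> \<equiv> Lambda_t n\<^sub>t n\<^sub>s (spectral U (($) s)) (spectral U (($) s')) \<beta> \<sigma>2"
  shows "finite \<Lambda> \<and> card \<Lambda> \<le> 4 * card (range (($) s)) - 1"
proof -
  define f where "f = (\<lambda>a k. \<Sum>i\<in>UNIV. a i / (s $ i + k)\<^sup>2)"
  define v where "v = (\<lambda>i. ((U *v \<beta>) $ i)\<^sup>2)"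
  let ?k = "kappa n\<^sub>t (spectral U (($) s))"
  have pos: "0 < l" if "l \<in> \<Lambda>" for l
    using that by (simp add: \<Lambda>_def Lambda_t_def)
  have k: "0 < ?k l" "penalty n\<^sub>t (($) s) (?k l) = l" if "l \<in> \<Lambda>" for l
    using kappa_eq_iff[of "($) s" l n\<^sub>t "?k l"] s pos[OF that] by simp_all
  have nz: "s $ i + ?k l \<noteq> 0" if "l \<in> \<Lambda>" for i l
    using s[of i] k(1)[OF that] by auto
  have balance: "((?k l)\<^sup>2 * f (\<lambda>i. s $ i * v i) (?k l) + \<sigma>2) * f (\<lambda>i. (s $ i)\<^sup>2 / real n\<^sub>t) (?k l)
      = (1 - f (\<lambda>i. (s $ i)\<^sup>2 / real n\<^sub>t) (?k l)) * ?k l * f (\<lambda>i. (s $ i)\<^sup>2 * v i) (?k l)"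
    if "l \<in> \<Lambda>" for l
    using balance_equation[of n\<^sub>t s s' l n\<^sub>s \<beta> \<sigma>2] n\<^sub>t s s' that by (simp add: f_def v_def \<Lambda>_def)
  show ?thesis
  proof (cases "\<beta> = 0")
    case True
    then have v0: "v i = 0" for i
      by (simp add: v_def)
    have "0 < \<sigma>2"
      using nontrivial True by simp
    have "l \<notin> \<Lambda>" for l
    proof
      assume l: "l \<in> \<Lambda>"
      have "0 < f (\<lambda>i. (s $ i)\<^sup>2 / real n\<^sub>t) (?k l)"
        unfolding f_def
      proof (intro sum_pos)
        fix i
        show "0 < (s $ i)\<^sup>2 / real n\<^sub>t / (s $ i + ?k l)\<^sup>2"
          using s[of i] n\<^sub>t nz[OF l, of i] by simp
      qed auto
      then show False
        using balance[OF l] \<open>0 < \<sigma>2\<close> by (simp add: v0 f_def)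
    qed
    then have "\<Lambda> = {}"
      by blast
    then show ?thesis
      by simp
  next
    case False
    have "U *v \<beta> \<noteq> 0"
    proof
      assume "U *v \<beta> = 0"
      then have "transpose U *v (U *v \<beta>) = 0"
        by simp
      with False show False
        by (simp add: matrix_vector_mul_assoc UtU)
    qed
    then obtain i where "(U *v \<beta>) $ i \<noteq> 0"
      by (auto simp: vec_eq_iff)
    then have "0 < (\<Sum>i\<in>UNIV. (s $ i)\<^sup>2 * v i)"
      using s[of i] by (intro sum_pos2[of _ i]) (auto simp: v_def)
    then have w: "(\<Sum>i\<in>UNIV. (s $ i)\<^sup>2 * v i) \<noteq> 0"
      by simp
    define S where "S = {k. (\<forall>i\<in>UNIV. s $ i + k \<noteq> 0) \<and>
      (k\<^sup>2 * f (\<lambda>i. s $ i * v i) k + \<sigma>2) * f (\<lambda>i. (s $ i)\<^sup>2 / real n\<^sub>t) k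
      = (1 - f (\<lambda>i. (s $ i)\<^sup>2 / real n\<^sub>t) k) * k * f (\<lambda>i. (s $ i)\<^sup>2 * v i) k}"
    have S: "finite S" "card S \<le> 4 * card (range (($) s)) - 1"
      unfolding S_def f_def
      by (rule card_balance_solutions[OF finite UNIV_not_empty w])+
    have "inj_on ?k \<Lambda>"
      using k(2) by (metis inj_onI)
    moreover have "?k ` \<Lambda> \<subseteq> S"
      using nz balance by (auto simp: S_def)
    ultimately show ?thesis
      using S card_inj_on_le[of ?k \<Lambda> S] inj_on_finite[of ?k \<Lambda> S] by linarith
  qed
qed

end

lemma ordered_eigenvalue_range:
  assumes "finite (eigenvalues A)"
  shows "ordered_eigenvalue A ` {1..card (eigenvalues A)} = eigenvalues A"
proof -
  have Suc: "{1..card (eigenvalues A)} = Suc ` {0..<card (eigenvalues A)}"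
    by (simp add: atLeastLessThanSuc_atLeastAtMost)
  have "ordered_eigenvalue A ` {1..card (eigenvalues A)}
      = (!) (sorted_list_of_set (eigenvalues A)) ` {0..<length (sorted_list_of_set (eigenvalues A))}"
    unfolding Suc ordered_eigenvalue_def image_image by simp
  also have "\<dots> = set (sorted_list_of_set (eigenvalues A))"
    by (auto simp: set_conv_nth image_def)
  finally show ?thesis
    using assms by simp
qed

theorem mainTheorem3:
  fixes n\<^sub>t n\<^sub>s :: nat
    and \<Sigma>\<^sub>t \<Sigma>\<^sub>s U :: "real ^ 'p ^ 'p"
    and s s' \<beta> :: "real ^ 'p"
    and \<sigma>2 :: real
  assumes "0 < n\<^sub>t" and "0 < n\<^sub>s"
    and "pos_def_matrix \<Sigma>\<^sub>t" and "pos_def_matrix \<Sigma>\<^sub>s"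
    and "orthogonal_matrix U"
    and "\<Sigma>\<^sub>t = transpose U ** diag_matrix s ** U"
    and "\<Sigma>\<^sub>s = transpose U ** diag_matrix s' ** U"
    and "0 \<le> \<sigma>2"
  shows "(\<forall>l\<^sub>t>0. l\<^sub>t \<in> Lambda_t n\<^sub>t n\<^sub>s \<Sigma>\<^sub>t \<Sigma>\<^sub>s \<beta> \<sigma>2 \<longleftrightarrow>
             (\<forall>j\<in>{1..card (eigenvalues \<Sigma>\<^sub>s)}. d_coeff n\<^sub>t \<Sigma>\<^sub>t \<Sigma>\<^sub>s \<beta> \<sigma>2 U s s' l\<^sub>t j = 0)) \<and>
         (0 < (norm \<beta>)\<^sup>2 + \<sigma>2 \<longrightarrow>
             finite (Lambda_t n\<^sub>t n\<^sub>s \<Sigma>\<^sub>t \<Sigma>\<^sub>s \<beta> \<sigma>2) \<and>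
             card (Lambda_t n\<^sub>t n\<^sub>s \<Sigma>\<^sub>t \<Sigma>\<^sub>s \<beta> \<sigma>2) \<le> 4 * card (eigenvalues \<Sigma>\<^sub>t) - 1)"
proof -
  have \<Sigma>\<^sub>t: "\<Sigma>\<^sub>t = spectral U (($) s)" and \<Sigma>\<^sub>s: "\<Sigma>\<^sub>s = spectral U (($) s')"
    using assms(6,7) by (simp_all add: spectral_def)
  have s: "0 < s $ i" and s': "0 < s' $ i" for i
    using pos_def_spectral[OF assms(5)] assms(3,4) by (simp_all add: \<Sigma>\<^sub>t \<Sigma>\<^sub>s)
  have ev: "eigenvalues \<Sigma>\<^sub>t = range (($) s)" "eigenvalues \<Sigma>\<^sub>s = range (($) s')"
    by (simp_all add: \<Sigma>\<^sub>t \<Sigma>\<^sub>s eigenvalues_spectral[OF assms(5)])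
  have "l\<^sub>t \<in> Lambda_t n\<^sub>t n\<^sub>s \<Sigma>\<^sub>t \<Sigma>\<^sub>s \<beta> \<sigma>2 \<longleftrightarrow>
      (\<forall>j\<in>{1..card (eigenvalues \<Sigma>\<^sub>s)}. d_coeff n\<^sub>t \<Sigma>\<^sub>t \<Sigma>\<^sub>s \<beta> \<sigma>2 U s s' l\<^sub>t j = 0)" if "0 < l\<^sub>t" for l\<^sub>t
  proof -
    have "l\<^sub>t \<in> Lambda_t n\<^sub>t n\<^sub>s \<Sigma>\<^sub>t \<Sigma>\<^sub>s \<beta> \<sigma>2 \<longleftrightarrow>
      (\<forall>e\<in>eigenvalues \<Sigma>\<^sub>s. (\<Sum>k | s' $ k = e. c_coeff n\<^sub>t \<Sigma>\<^sub>t \<beta> \<sigma>2 U s l\<^sub>t k) = 0)"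
      using mem_Lambda_t_iff[OF assms(5) s s' that] by (simp add: ev flip: \<Sigma>\<^sub>t \<Sigma>\<^sub>s)
    also have "eigenvalues \<Sigma>\<^sub>s = ordered_eigenvalue \<Sigma>\<^sub>s ` {1..card (eigenvalues \<Sigma>\<^sub>s)}"
      by (rule ordered_eigenvalue_range[symmetric]) (simp add: ev)
    finally show ?thesis
      by (simp add: d_coeff_def)
  qed
  moreover have "finite (Lambda_t n\<^sub>t n\<^sub>s \<Sigma>\<^sub>t \<Sigma>\<^sub>s \<beta> \<sigma>2) \<and>
      card (Lambda_t n\<^sub>t n\<^sub>s \<Sigma>\<^sub>t \<Sigma>\<^sub>s \<beta> \<sigma>2) \<le> 4 * card (eigenvalues \<Sigma>\<^sub>t) - 1"
    if "0 < (norm \<beta>)\<^sup>2 + \<sigma>2"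
    unfolding ev unfolding \<Sigma>\<^sub>t \<Sigma>\<^sub>s by (rule card_Lambda_t[OF assms(5,1) s s' assms(8) that])
  ultimately show ?thesis
    by blast
qed

end
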